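(* For every $X\subseteq\mathbb{N}$, the Boolean frame $\mathfrak{A}_X$ does not have the congruence extension property.
   Context: A Boolean frame is an algebra $\langle A,\sqcap,-,0,f\rangle$ with $\langle A,\sqcap,-,0\rangle$ a Boolean algebra and $f:A\to A$ an arbitrary unary operation. An algebra has the congruence extension property (CEP) if for every subalgebra $B$ and every congruence $\Theta$ of $B$ there is a congruence $\Psi$ of the algebra with $\Psi\cap(B\times B)=\Theta$. Let $E=\{2n:n\in\mathbb{N}\}$ and $2E=\{2n:n\in E\}$. For $X\subseteq\mathbb{N}$, $\mathfrak{A}_X=\langle\mathcal{P}(\mathbb{N}),f\rangle$ is the powerset Boolean algebra of $\mathbb{N}$ with $f$ defined for $S\subseteq\mathbb{N}$ by: $f(S)=\{0,\dots,n\}$ if $S=\{0,\dots,n-1\}$ for some $n\in\mathbb{N}$ (so $f(\emptyset)=\{0\}$); $f(S)=\mathbb{N}$ if $S=2E$; $f(S)=\mathbb{N}$ if $S=\mathbb{N}\setminus\{0,\dots,n\}$ for some $n\in X$; and $f(S)=S$ otherwise. *)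

theory Defs
  imports Main
begin

text \<open>
  A Boolean frame is a unary operation \<open>f\<close> on a type of class \<^class>\<open>boolean_algebra\<close>:
  the class supplies meet, complement and zero, and the universe of the algebra is
  \<^term>\<open>UNIV\<close>. Subalgebras are represented by their universes, and a congruence \<open>\<Theta>\<close> of
  the subalgebra with universe \<open>B\<close> is a relation contained in \<open>B \<times> B\<close> (this containment
  is part of \<^const>\<open>equiv\<close>).
\<close>

definition subalgebra :: "('a::boolean_algebra \<Rightarrow> 'a) \<Rightarrow> 'a set \<Rightarrow> bool" where
  "subalgebra f B \<longleftrightarrow>
     bot \<in> B \<and>
     (\<forall>a\<in>B. \<forall>b\<in>B. inf a b \<in> B) \<and>
     (\<forall>a\<in>B. - a \<in> B) \<and>
     (\<forall>a\<in>B. f a \<in> B)"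

definition congruence_on :: "('a::boolean_algebra \<Rightarrow> 'a) \<Rightarrow> 'a set \<Rightarrow> ('a \<times> 'a) set \<Rightarrow> bool" where
  "congruence_on f B \<Theta> \<longleftrightarrow>
     equiv B \<Theta> \<and>
     (\<forall>a b c d. (a, b) \<in> \<Theta> \<longrightarrow> (c, d) \<in> \<Theta> \<longrightarrow> (inf a c, inf b d) \<in> \<Theta>) \<and>
     (\<forall>a b. (a, b) \<in> \<Theta> \<longrightarrow> (- a, - b) \<in> \<Theta>) \<and>
     (\<forall>a b. (a, b) \<in> \<Theta> \<longrightarrow> (f a, f b) \<in> \<Theta>)"

definition congruence_extension_property :: "('a::boolean_algebra \<Rightarrow> 'a) \<Rightarrow> bool" where
  "congruence_extension_property f \<longleftrightarrow>
     (\<forall>B \<Theta>. subalgebra f B \<longrightarrow> congruence_on f B \<Theta> \<longrightarrow>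
        (\<exists>\<Psi>. congruence_on f UNIV \<Psi> \<and> \<Psi> \<inter> (B \<times> B) = \<Theta>))"

definition evens :: "nat set" where
  "evens = {2 * n | n. True}"

definition double_evens :: "nat set" where
  "double_evens = {2 * n | n. n \<in> evens}"

text \<open>
  The frame \<open>\<AA>\<^sub>X\<close> is \<^typ>\<open>nat set\<close>, with its set-theoretic Boolean structure, equipped
  with \<open>frame_op X\<close>. The cases are mutually exclusive (a finite set, an infinite
  co-infinite set, an infinite co-finite set), so their order is immaterial.
\<close>

definition frame_op :: "nat set \<Rightarrow> nat set \<Rightarrow> nat set" where
  "frame_op X S =
     (if \<exists>n. S = {..<n} then {..(THE n. S = {..<n})}
      else if S = double_evens then UNIV
      else if \<exists>n\<in>X. S = UNIV - {..n} then UNIV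
      else S)"

lemma frame_op_lessThan: "frame_op X {..<n} = {..n}"
  by (simp add: frame_op_def)

lemma frame_op_empty: "frame_op X {} = {0}"
  using frame_op_lessThan[of X 0] by auto

lemma infinite_double_evens: "infinite double_evens"
proof -
  have "double_evens = range (\<lambda>n. 4 * n)"
    by (auto simp: double_evens_def evens_def image_def)
  moreover have "infinite (range (\<lambda>n::nat. 4 * n))"
    by (auto simp: inj_def dest: finite_imageD)
  ultimately show ?thesis by simp
qed

lemma frame_op_double_evens: "frame_op X double_evens = UNIV"
proof -
  have "double_evens \<noteq> {..<n}" for n
    using infinite_double_evens finite_lessThan by metis
  then show ?thesis by (simp add: frame_op_def)
qed

lemma frame_op_cofinal:
  assumes "n \<in> X" shows "frame_op X (UNIV - {..n}) = UNIV"
proof -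
  have "infinite (UNIV - {..n})"
    by (simp add: Diff_infinite_finite)
  then have "UNIV - {..n} \<noteq> {..<m}" for m
    using finite_lessThan by metis
  then show ?thesis using assms by (auto simp: frame_op_def)
qed

lemma frame_op_other:
  assumes "\<And>n. S \<noteq> {..<n}" "S \<noteq> double_evens" "\<And>n. n \<in> X \<Longrightarrow> S \<noteq> UNIV - {..n}"
  shows "frame_op X S = S"
  using assms by (auto simp: frame_op_def)

end

theory Submission
  imports Defs
begin

text \<open>
  On every set other than \<open>2E\<close> the operation changes only finitely many elements. The sets
  \<open>S\<close> for which \<open>S \<inter> E\<close> is finite or cofinite in \<open>E\<close> form a subalgebra \<open>B\<close> that omits \<open>2E\<close>,
  so on \<open>B\<close> equality up to finitely many elements outside \<open>E\<close> is a congruence \<open>\<Theta>\<close>; it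
  identifies \<open>E\<close> with \<open>\<emptyset>\<close> but not \<open>\<nat>\<close> with \<open>\<emptyset>\<close>. A congruence of the whole frame extending
  \<open>\<Theta>\<close> would identify \<open>2E = E \<inter> 2E\<close> with \<open>\<emptyset>\<close>, hence \<open>\<nat> = f(2E)\<close> with \<open>f(\<emptyset>) = {0}\<close>, which
  is \<open>\<Theta>\<close>-related to \<open>\<emptyset>\<close>.
\<close>

text \<open>An initial segment gains one point, a cofinite set \<open>UNIV - {..n}\<close> with
  \<open>n \<in> X\<close> gains \<open>{..n}\<close>, and any other set in question is
  fixed.\<close>

lemma finite_sym_diff_frame_op:
  assumes "S \<noteq> double_evens"
  shows "finite (sym_diff (frame_op X S) S)"
proof -
  consider n where "S = {..<n}" | n where "n \<in> X" "S = UNIV - {..n}"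
    | "frame_op X S = S"
    using assms frame_op_other by metis
  then show ?thesis
  proof cases
    case 1
    then show ?thesis by (simp add: frame_op_lessThan)
  next
    case 2
    then have "sym_diff (frame_op X S) S = {..n}"
      by (auto simp: frame_op_cofinal)
    then show ?thesis by simp
  qed simp
qed

text \<open>The preimage of the finite-cofinite algebra on \<open>evens\<close> under the map
  sending \<open>S\<close> to \<open>S \<inter> evens\<close>.\<close>

definition even_trivial_sets :: "nat set set" where
  "even_trivial_sets = {S. finite (S \<inter> evens) \<or> finite (evens - S)}"

text \<open>The Boolean congruence of the ideal of sets with finitely many elements outside
  \<open>evens\<close>, restricted to the subalgebra. Without the restriction, the pair of
  \<open>double_evens\<close> and \<open>{}\<close> would break compatibility with
  \<open>frame_op\<close>.\<close>

definition eq_mod_evens :: "(nat set \<times> nat set) set" where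
  "eq_mod_evens = {(S, T). S \<in> even_trivial_sets \<and> T \<in> even_trivial_sets \<and>
     finite (sym_diff S T - evens)}"

lemma double_evens_subset_evens: "double_evens \<subseteq> evens"
  by (auto simp: double_evens_def evens_def)

lemma infinite_evens_diff_double_evens: "infinite (evens - double_evens)"
proof -
  have "range (\<lambda>n::nat. 4 * n + 2) \<subseteq> evens - double_evens"
  proof
    fix m :: nat
    assume "m \<in> range (\<lambda>n. 4 * n + 2)"
    then obtain n where "m = 4 * n + 2" by blast
    then have "m = 2 * (2 * n + 1)" "\<And>k. m \<noteq> 2 * (2 * k)" by presburger+
    then show "m \<in> evens - double_evens"
      unfolding evens_def double_evens_def by blast
  qed
  moreover have "infinite (range (\<lambda>n::nat. 4 * n + 2))"
    by (auto simp: inj_def dest: finite_imageD)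
  ultimately show ?thesis using finite_subset by blast
qed

lemma infinite_Compl_evens: "infinite (- evens)"
proof -
  have "range (\<lambda>n::nat. 2 * n + 1) \<subseteq> - evens"
  proof
    fix m :: nat
    assume "m \<in> range (\<lambda>n. 2 * n + 1)"
    then obtain n where "m = 2 * n + 1" by blast
    then have "\<And>k. m \<noteq> 2 * k" by presburger
    then show "m \<in> - evens"
      unfolding evens_def by blast
  qed
  moreover have "infinite (range (\<lambda>n::nat. 2 * n + 1))"
    by (auto simp: inj_def dest: finite_imageD)
  ultimately show ?thesis using finite_subset by blast
qed

lemma double_evens_notin_even_trivial_sets: "double_evens \<notin> even_trivial_sets"
  using infinite_double_evens infinite_evens_diff_double_evens double_evens_subset_evens
  by (simp add: even_trivial_sets_def Int_absorb2)

text \<open>A finite change of \<open>S\<close> alters \<open>S \<inter> evens\<close> and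
  \<open>evens - S\<close> only finitely. Closure under \<open>frame_op\<close> follows from
  this.\<close>

lemma even_trivial_sets_finite_sym_diff:
  assumes "S \<in> even_trivial_sets" "finite (sym_diff T S)"
  shows "T \<in> even_trivial_sets"
proof -
  have "T \<inter> evens \<subseteq> (S \<inter> evens) \<union> sym_diff T S" "evens - T \<subseteq> (evens - S) \<union> sym_diff T S"
    by auto
  then show ?thesis
    using assms unfolding even_trivial_sets_def mem_Collect_eq
    by (meson finite_UnI finite_subset)
qed

lemma finite_sym_diff_frame_op_even_trivial:
  assumes "S \<in> even_trivial_sets"
  shows "finite (sym_diff (frame_op X S) S)"
  using assms double_evens_notin_even_trivial_sets finite_sym_diff_frame_op by metis

lemma even_trivial_sets_inter:
  assumes "S \<in> even_trivial_sets" "T \<in> even_trivial_sets"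
  shows "S \<inter> T \<in> even_trivial_sets"
proof -
  \<comment> \<open>If either trace on \<open>evens\<close> is finite, so is that of the
    intersection; otherwise both are cofinite in \<open>evens\<close>, and the last equation
    applies.\<close>
  have "S \<inter> T \<inter> evens \<subseteq> S \<inter> evens" "S \<inter> T \<inter> evens \<subseteq> T \<inter> evens"
    "evens - S \<inter> T = (evens - S) \<union> (evens - T)"
    by auto
  then show ?thesis
    using assms unfolding even_trivial_sets_def mem_Collect_eq
    by (metis finite_UnI finite_subset)
qed

lemma even_trivial_sets_Compl:
  assumes "S \<in> even_trivial_sets"
  shows "- S \<in> even_trivial_sets"
proof -
  have "- S \<inter> evens = evens - S" "evens - - S = S \<inter> evens"
    by auto
  then show ?thesis
    using assms by (auto simp: even_trivial_sets_def)
qed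

lemma even_trivial_sets_frame_op:
  assumes "S \<in> even_trivial_sets"
  shows "frame_op X S \<in> even_trivial_sets"
  using assms even_trivial_sets_finite_sym_diff finite_sym_diff_frame_op_even_trivial by metis

lemma subalgebra_even_trivial_sets: "subalgebra (frame_op X) even_trivial_sets"
  unfolding subalgebra_def
  using even_trivial_sets_inter even_trivial_sets_Compl even_trivial_sets_frame_op
  by (auto simp: even_trivial_sets_def)

lemma equiv_eq_mod_evens: "equiv even_trivial_sets eq_mod_evens"
proof (rule equivI)
  show "eq_mod_evens \<subseteq> even_trivial_sets \<times> even_trivial_sets"
    by (auto simp: eq_mod_evens_def)
  show "refl_on even_trivial_sets eq_mod_evens"
    by (auto simp: refl_on_def eq_mod_evens_def)
  show "sym eq_mod_evens"
    by (auto simp: sym_def eq_mod_evens_def Un_commute)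
  show "trans eq_mod_evens"
  proof (rule transI)
    fix S T U
    assume "(S, T) \<in> eq_mod_evens" "(T, U) \<in> eq_mod_evens"
    moreover have "sym_diff S U - evens \<subseteq> (sym_diff S T - evens) \<union> (sym_diff T U - evens)"
      by auto
    ultimately show "(S, U) \<in> eq_mod_evens"
      unfolding eq_mod_evens_def by (auto intro: finite_subset)
  qed
qed

lemma eq_mod_evens_inter:
  assumes "(S, T) \<in> eq_mod_evens" "(U, V) \<in> eq_mod_evens"
  shows "(S \<inter> U, T \<inter> V) \<in> eq_mod_evens"
proof -
  have "sym_diff (S \<inter> U) (T \<inter> V) - evens \<subseteq> (sym_diff S T - evens) \<union> (sym_diff U V - evens)"
    by auto
  then have "finite (sym_diff (S \<inter> U) (T \<inter> V) - evens)"
    by (rule finite_subset) (use assms in \<open>simp add: eq_mod_evens_def\<close>)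
  then show ?thesis
    using assms even_trivial_sets_inter by (simp add: eq_mod_evens_def)
qed

lemma eq_mod_evens_Compl:
  assumes "(S, T) \<in> eq_mod_evens"
  shows "(- S, - T) \<in> eq_mod_evens"
proof -
  have "sym_diff (- S) (- T) = sym_diff S T"
    by auto
  then show ?thesis
    using assms even_trivial_sets_Compl by (simp add: eq_mod_evens_def)
qed

text \<open>Passing from \<open>frame_op X S\<close> to \<open>S\<close>, then to \<open>T\<close>,
  then to \<open>frame_op X T\<close> changes only finitely many elements outside
  \<open>evens\<close> at each stage.\<close>

lemma eq_mod_evens_frame_op:
  assumes "(S, T) \<in> eq_mod_evens"
  shows "(frame_op X S, frame_op X T) \<in> eq_mod_evens"
proof -
  have mem: "S \<in> even_trivial_sets" "T \<in> even_trivial_sets"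
    and fin: "finite (sym_diff S T - evens)"
    using assms by (auto simp: eq_mod_evens_def)
  have "sym_diff (frame_op X S) (frame_op X T) - evens
      \<subseteq> sym_diff (frame_op X S) S \<union> (sym_diff S T - evens) \<union> sym_diff (frame_op X T) T"
    by auto
  then have "finite (sym_diff (frame_op X S) (frame_op X T) - evens)"
    by (rule finite_subset)
      (intro finite_UnI[OF finite_UnI] finite_sym_diff_frame_op_even_trivial mem fin)
  then show ?thesis
    using mem even_trivial_sets_frame_op by (simp add: eq_mod_evens_def)
qed

lemma congruence_on_eq_mod_evens: "congruence_on (frame_op X) even_trivial_sets eq_mod_evens"
  unfolding congruence_on_def
  using equiv_eq_mod_evens eq_mod_evens_inter eq_mod_evens_Compl eq_mod_evens_frame_op
  by blast

theorem theorem2p2: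
  fixes X :: "nat set"
  shows "\<not> congruence_extension_property (frame_op X)"
proof
  assume "congruence_extension_property (frame_op X)"
  then obtain \<Psi> where \<Psi>: "congruence_on (frame_op X) UNIV \<Psi>"
    and ext: "\<Psi> \<inter> (even_trivial_sets \<times> even_trivial_sets) = eq_mod_evens"
    unfolding congruence_extension_property_def
    using subalgebra_even_trivial_sets congruence_on_eq_mod_evens by blast
  have equiv: "equiv UNIV \<Psi>"
    and inter: "\<And>S T U V. (S, T) \<in> \<Psi> \<Longrightarrow> (U, V) \<in> \<Psi> \<Longrightarrow> (S \<inter> U, T \<inter> V) \<in> \<Psi>"
    and op: "\<And>S T. (S, T) \<in> \<Psi> \<Longrightarrow> (frame_op X S, frame_op X T) \<in> \<Psi>"
    using \<Psi> by (auto simp: congruence_on_def)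
  have "(evens, {}) \<in> eq_mod_evens" "({0}, {}) \<in> eq_mod_evens"
    by (auto simp: eq_mod_evens_def even_trivial_sets_def)
  then have evens: "(evens, {}) \<in> \<Psi>" and zero: "({0}, {}) \<in> \<Psi>"
    using ext by auto
  \<comment> \<open>Reflexivity of \<open>\<Psi>\<close> on all of \<open>UNIV\<close> is essential
    here, as \<open>double_evens\<close> lies outside the subalgebra.\<close>
  have "(double_evens, double_evens) \<in> \<Psi>"
    using equiv by (simp add: equiv_def refl_on_def)
  from inter[OF evens this] have "(double_evens, {}) \<in> \<Psi>"
    using double_evens_subset_evens by (simp add: Int_absorb1)
  from op[OF this] have "(UNIV, {0}) \<in> \<Psi>"
    by (simp add: frame_op_double_evens frame_op_empty)
  with zero have "(UNIV, {}) \<in> \<Psi>"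
    using equiv by (meson equivE transD)
  \<comment> \<open>Both \<open>UNIV\<close> and \<open>{}\<close> lie in the subalgebra, so the
    pair falls back under \<open>ext\<close>.\<close>
  then have "(UNIV, {}) \<in> \<Psi> \<inter> (even_trivial_sets \<times> even_trivial_sets)"
    by (simp add: even_trivial_sets_def)
  then have "(UNIV, {}) \<in> eq_mod_evens"
    unfolding ext .
  then show False
    using infinite_Compl_evens by (simp add: eq_mod_evens_def flip: Compl_eq_Diff_UNIV)
qed

end
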